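(* Let $\mathcal H$ be a real Hilbert space, $C\subseteq\mathcal H$ nonempty closed convex, and let $B\colon\mathcal H\to\mathcal H$ be $L$-Lipschitz ($L>0$) and $\sigma$-strongly monotone for some $\sigma>0$, with solution set $S$ nonempty (hence $S=\{z\}$). Let $(\beta_k)$ satisfy $0\le\beta_k\le\tfrac14$ and $\sum_k\beta_k<\infty$, set $\theta_k=1-\beta_k$, fix $x_{-1}=x_0=u_0\in C$, let $$0<\lambda\le\min\Bigl\{\tfrac1{5L},\tfrac1{32\sigma}\Bigr\},$$ and define $$x_{k+1}=P_C\bigl(x_k-\lambda B(u_k)\bigr)\quad(k\ge0),\qquad u_k=x_k+\theta_k(x_k-x_{k-1})+\beta_k(x_k-u_{k-1})\quad(k\ge1).$$ Then $x_k\to z$ strongly with the $R$-linear bound $$\|x_k-z\|^2\le K\,(1-\lambda\sigma)^k\qquad(k\ge0),$$ where, with $\rho=1-\lambda\sigma$ and $\epsilon_k=100\,\lambda L\,\beta_k$, $$K=\max\{a_0,a_1/\rho\}\prod_{j\ge1}\bigl(1+\epsilon_j/\rho^2\bigr)<\infty,$$ and $(a_k)$ is the Lyapunov sequence defined in the context. In particular $\|x_k-z\|=O\bigl((1-\lambda\sigma)^{k/2}\bigr)$, and the increments satisfy $\|x_{k+1}-x_k\|,\ \|u_k-x_k\|=O\bigl((1-\lambda\sigma)^{k/2}\bigr)$.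
   Context: $P_C$ is the metric projection onto $C$. $B$ is $\sigma$-strongly monotone if $\langle B(x)-B(y),x-y\rangle\ge\sigma\|x-y\|^2$ for all $x,y\in\mathcal H$. The solution set is $S=\{z\in C:\langle B(z),x-z\rangle\ge0\ \forall x\in C\}$. Lyapunov sequence: with $e_k=u_k-x_k$ and the conventions $u_{-1}=x_0$, $e_{-1}=0$, $$a_k=\|x_k-z\|^2+\tfrac73\lambda L\|x_k-u_{k-1}\|^2+2\lambda\langle B(z),x_{k-1}-z\rangle+\tfrac13\|e_{k-1}\|^2\qquad(k\ge0).$$ *)

theory Defs
  imports "HOL-Analysis.Analysis" "HOL-Library.Landau_Symbols"
begin

text \<open>
  The library's \<open>closest_point\<close> is restricted to the sort \<open>heine_borel\<close>, hence to finite
  dimension; this is the same definition for an arbitrary real inner product space. The value is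
  meaningful when a nearest point exists, as it does (uniquely) for nonempty closed convex sets
  in a Hilbert space.
\<close>

definition metric_projection :: "'a::real_inner set \<Rightarrow> 'a \<Rightarrow> 'a" where
  "metric_projection C a = (SOME p. p \<in> C \<and> (\<forall>y\<in>C. dist a p \<le> dist a y))"

definition strongly_monotone :: "real \<Rightarrow> ('a::real_inner \<Rightarrow> 'a) \<Rightarrow> bool" where
  "strongly_monotone \<sigma> B \<longleftrightarrow> (\<forall>x y. inner (B x - B y) (x - y) \<ge> \<sigma> * (norm (x - y))\<^sup>2)"

definition vi_solutions :: "'a::real_inner set \<Rightarrow> ('a \<Rightarrow> 'a) \<Rightarrow> 'a set" where
  "vi_solutions C B = {z \<in> C. \<forall>x\<in>C. inner (B z) (x - z) \<ge> 0}"

text \<open>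
  \<open>prev s0 s k\<close> is $s_{k-1}$ for a sequence indexed from $-1$, stored as its initial term
  $s_{-1} = s0$ and its part \<open>s\<close> indexed from $0$.
\<close>

definition prev :: "'a \<Rightarrow> (nat \<Rightarrow> 'a) \<Rightarrow> nat \<Rightarrow> 'a" where
  "prev s0 s k = (case k of 0 \<Rightarrow> s0 | Suc j \<Rightarrow> s j)"

text \<open>
  The initial terms passed to \<open>prev\<close> are the conventions $u_{-1} = x_0$, $x_{-1} = x_0$ and
  $e_{-1} = 0$, where $e_k = u_k - x_k$.
\<close>

definition lyapunov ::
  "('a::real_inner \<Rightarrow> 'a) \<Rightarrow> real \<Rightarrow> real \<Rightarrow> 'a \<Rightarrow> (nat \<Rightarrow> 'a) \<Rightarrow> (nat \<Rightarrow> 'a) \<Rightarrow> nat \<Rightarrow> real" where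
  "lyapunov B L lam z x u k =
     (norm (x k - z))\<^sup>2
     + 7 / 3 * lam * L * (norm (x k - prev (x 0) u k))\<^sup>2
     + 2 * lam * inner (B z) (prev (x 0) x k - z)
     + 1 / 3 * (norm (prev 0 (\<lambda>j. u j - x j) k))\<^sup>2"

end

theory Submission
  imports Defs
begin

text \<open>
  Write $d_k = x_k - x_{k-1}$, $e_k = u_k - x_k$, so that $e_k = d_k - \beta_k e_{k-1}$. For $k \ge 1$
  the variational inequality of the projection giving $x_{k+1}$ is tested with $z$, and the one
  giving $x_k$ with $x_{k+1}$ (weight $1$) and $x_{k-1}$ (weight $1 - \lambda\sigma$). In the weighted
  sum $B(u_{k-1})$ is paired only with $\lambda\sigma d_k - \beta_k e_{k-1}$, and comparing it with
  $B(z)$ leaves $(1-\lambda\sigma) \langle B(z), x_{k-1} - z\rangle$ on the right: the reduced weight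
  is what makes the $B(z)$-part of $a_k$ contract as well. The other terms form a quadratic form that
  Young's inequality controls, and $a_{k+1} \le (\rho + \epsilon_k) a_k$ follows for $k \ge 1$.
\<close>

section \<open>Metric projection in a Hilbert space\<close>

text \<open>A minimizing sequence for the squared distance is Cauchy by the parallelogram law and
  convexity; completeness and closedness then put its limit in \<open>C\<close>.\<close>

lemma nearest_point_exists:
  fixes C :: "'a::{real_inner, complete_space} set"
  assumes "C \<noteq> {}" "closed C" "convex C"
  shows "\<exists>p\<in>C. \<forall>y\<in>C. dist a p \<le> dist a y"
proof -
  define m where "m = (INF y\<in>C. (dist a y)\<^sup>2)"
  have bdd: "bdd_below ((\<lambda>y. (dist a y)\<^sup>2) ` C)"
    by (rule bdd_belowI2[of _ 0]) simp
  have m_le: "m \<le> (dist a y)\<^sup>2" if "y \<in> C" for y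
    unfolding m_def by (rule cINF_lower[OF bdd that])
  have "\<exists>y\<in>C. (dist a y)\<^sup>2 < m + inverse (real (Suc n))" for n
    using cINF_less_iff[OF assms(1) bdd, of "m + inverse (real (Suc n))"] by (simp add: m_def)
  then obtain Y where Y: "\<And>n. Y n \<in> C" "\<And>n. (dist a (Y n))\<^sup>2 < m + inverse (real (Suc n))"
    by metis
  \<comment> \<open>The midpoint \<open>c\<close> lies in \<open>C\<close>, so its squared distance
    from \<open>a\<close> is at least \<open>m\<close>. In the parallelogram identity this cancels
    the two copies of \<open>2 * m\<close> and leaves only the excesses over the infimum.\<close>
  have gap: "(norm (Y i - Y j))\<^sup>2 \<le> 2 * inverse (real (Suc i)) + 2 * inverse (real (Suc j))" for i j
  proof -
    define c where "c = (1 / 2) *\<^sub>R Y i + (1 / 2) *\<^sub>R Y j"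
    have "c \<in> C"
      unfolding c_def using convexD[OF assms(3) Y(1)[of i] Y(1)[of j], of "1/2" "1/2"] by simp
    moreover have "(norm (Y i - Y j))\<^sup>2
        = 2 * (dist a (Y i))\<^sup>2 + 2 * (dist a (Y j))\<^sup>2 - 4 * (dist a c)\<^sup>2"
      unfolding c_def dist_norm power2_norm_eq_inner
      by (simp add: inner_simps inner_commute algebra_simps)
    ultimately show ?thesis
      using m_le[of c] Y(2)[of i] Y(2)[of j] by linarith
  qed
  have "Cauchy Y"
  proof (rule CauchyI)
    fix e :: real
    assume "0 < e"
    then obtain M where M: "inverse (real (Suc M)) < e\<^sup>2 / 4"
      using reals_Archimedean[of "e\<^sup>2 / 4"] by auto
    have "norm (Y i - Y j) < e" if "M \<le> i" "M \<le> j" for i j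
    proof -
      have "inverse (real (Suc i)) \<le> inverse (real (Suc M))" "inverse (real (Suc j)) \<le> inverse (real (Suc M))"
        using that by simp_all
      then have "(norm (Y i - Y j))\<^sup>2 < e\<^sup>2"
        using gap[of i j] M by linarith
      then show ?thesis
        using \<open>0 < e\<close> by (simp add: power2_less_imp_less)
    qed
    then show "\<exists>M. \<forall>i\<ge>M. \<forall>j\<ge>M. norm (Y i - Y j) < e" by blast
  qed
  then obtain p where p: "Y \<longlonglongrightarrow> p"
    using Cauchy_convergent convergent_def by blast
  have "p \<in> C"
    using closed_sequentially[OF assms(2)] Y(1) p by blast
  moreover have "(dist a p)\<^sup>2 \<le> m"
  proof (rule LIMSEQ_le)
    show "(\<lambda>n. (dist a (Y n))\<^sup>2) \<longlonglongrightarrow> (dist a p)\<^sup>2"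
      by (intro tendsto_intros p)
    show "(\<lambda>n. m + inverse (real (Suc n))) \<longlonglongrightarrow> m"
      using tendsto_add[OF tendsto_const[of m] LIMSEQ_inverse_real_of_nat] by simp
    show "\<exists>N. \<forall>n\<ge>N. (dist a (Y n))\<^sup>2 \<le> m + inverse (real (Suc n))"
      using Y(2) less_imp_le by blast
  qed
  then have "dist a p \<le> dist a y" if "y \<in> C" for y
    using m_le[OF that] by (meson order_trans power2_le_imp_le zero_le_dist)
  ultimately show ?thesis by blast
qed

text \<open>Existence of a nearest point makes the choice in \<open>metric_projection\<close>
  meaningful; minimality over a convex set then yields the variational inequality, the only property
  of the projection used later.\<close>

lemma metric_projection_mem_inner:
  fixes C :: "'a::{real_inner, complete_space} set"
  assumes "C \<noteq> {}" "closed C" "convex C"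
  shows "metric_projection C a \<in> C"
    and "y \<in> C \<Longrightarrow> inner (metric_projection C a - a) (y - metric_projection C a) \<ge> 0"
proof -
  have "\<exists>p. p \<in> C \<and> (\<forall>y\<in>C. dist a p \<le> dist a y)"
    using nearest_point_exists[OF assms, of a] by blast
  then have *: "metric_projection C a \<in> C \<and> (\<forall>y\<in>C. dist a (metric_projection C a) \<le> dist a y)"
    unfolding metric_projection_def by (rule someI_ex)
  then show "metric_projection C a \<in> C" by blast
  show "inner (metric_projection C a - a) (y - metric_projection C a) \<ge> 0" if "y \<in> C"
    using any_closest_point_dot[OF assms(3,2) _ that, of "metric_projection C a" a] *
    by (simp add: inner_diff_left)
qed

section \<open>Uniqueness of the solution\<close>

text \<open>Testing each of two solutions with the other and adding gives
  \<open>inner (B y - B z) (y - z) \<le> 0\<close>, which strong monotonicity allows only for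
  \<open>y = z\<close>.\<close>

lemma vi_solutions_unique:
  assumes "\<sigma> > 0" "strongly_monotone \<sigma> B" "z \<in> vi_solutions C B"
  shows "vi_solutions C B = {z}"
proof -
  have "y = z" if "y \<in> vi_solutions C B" for y
  proof -
    have "inner (B z) (y - z) \<ge> 0" "inner (B y) (z - y) \<ge> 0"
      using that assms(3) by (auto simp: vi_solutions_def)
    moreover have "inner (B y - B z) (y - z) \<ge> \<sigma> * (norm (y - z))\<^sup>2"
      using assms(2) by (simp add: strongly_monotone_def)
    ultimately have "\<sigma> * (norm (y - z))\<^sup>2 \<le> 0"
      by (simp add: inner_simps)
    then show ?thesis
      using assms(1) by (simp add: mult_le_0_iff)
  qed
  then show ?thesis using assms(3) by blast
qed

section \<open>The one-step inequality for scalars and vectors\<close>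

text \<open>
  Here $s = \lambda L$, $t = \lambda\sigma$, and $P, D, E, W, V, F$ are the norms of $x_k - z$, $d_k$,
  $e_{k-1}$, $x_{k+1} - u_k$, $x_k - u_{k-1}$, $e_k$.
\<close>

lemma step_scalar_bound:
  fixes s t \<beta> P D E W V F :: real
  assumes s: "0 \<le> s" "s \<le> 1/5" and t: "0 \<le> t" "t \<le> 1/32" and b: "0 \<le> \<beta>" "\<beta> \<le> 1/4"
    and nn: "0 \<le> P" "0 \<le> D" "0 \<le> E" "0 \<le> W" "0 \<le> V" "0 \<le> F" and F: "F \<le> D + \<beta> * E"
  shows "7/3 * s * W\<^sup>2 + 1/3 * F\<^sup>2 - (W\<^sup>2 - 2 * \<beta> * W * E + \<beta>\<^sup>2 * E\<^sup>2) - (1 - 2 * t) * D\<^sup>2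
      + 2 * s * (V + F) * W + 2 * s * (P + V) * (t * D + \<beta> * E) + t * (4 * P * F - P\<^sup>2 - 2 * F\<^sup>2)
    \<le> (1 - t) * (7/3 * s * V\<^sup>2 + 1/3 * E\<^sup>2) + 100 * s * \<beta> * (P\<^sup>2 + 1/3 * E\<^sup>2)"
proof -
  \<comment> \<open>Young's inequality from the square of \<open>r * A - G\<close>, divided by
    \<open>r\<close>. The common factor \<open>c\<close> stays outside so that products such as
    \<open>s * t\<close> and \<open>s * \<beta>\<close> survive as coefficients.\<close>
  have young: "2 * (c * A * G) \<le> r * (c * A\<^sup>2) + q * (c * G\<^sup>2)" if "0 \<le> c" "0 < r" "1 \<le> r * q"
    for c A G r q :: real
  proof -
    have "0 \<le> (r * A - G)\<^sup>2" by simp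
    also have "\<dots> = r * (r * A\<^sup>2 - 2 * A * G) + G\<^sup>2"
      by (simp add: power2_eq_square algebra_simps)
    also have "\<dots> \<le> r * (r * A\<^sup>2 - 2 * A * G) + (r * q) * G\<^sup>2"
      using mult_right_mono[OF that(3), of "G\<^sup>2"] by simp
    also have "\<dots> = r * (r * A\<^sup>2 + q * G\<^sup>2 - 2 * A * G)"
      by (simp add: algebra_simps)
    finally have "0 \<le> r * A\<^sup>2 + q * G\<^sup>2 - 2 * A * G"
      using that(2) by (simp add: zero_le_mult_iff)
    from mult_left_mono[OF this that(1)] show ?thesis by (simp add: algebra_simps)
  qed
  have st: "0 \<le> s * t" "s * t \<le> 1/32 * s" "s * t \<le> 1/5 * t"
    using mult_left_mono[OF t(2) s(1)] mult_right_mono[OF s(2) t(1)] s t by simp_all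
  have sb: "0 \<le> s * \<beta>" "s * \<beta> \<le> 1/4 * s"
    using mult_left_mono[OF b(2) s(1)] s b by simp_all
  have bb: "\<beta>\<^sup>2 \<le> 1/16"
    using power_mono[OF b(2) b(1), of 2] by (simp add: power2_eq_square)
  have scale: "c * A\<^sup>2 \<le> r * A\<^sup>2" if "c \<le> r" for c r A :: real
    using that by (intro mult_right_mono) auto
  note young_terms =
    young[OF s(1), of 2 "1/2" V W] young[OF s(1), of 1 1 F W]
    young[OF st(1), of "1/2" 2 P D] young[OF st(1), of 1 1 V D]
    young[OF sb(1), of 1 1 P E] young[OF sb(1), of "1/2" 2 V E]
    young[OF t(1), of "9/20" "20/9" P F] young[of 1 "7/30" "30/7" W "\<beta> * E"]
  note scale_terms =
    scale[OF st(3), of P] scale[OF st(3), of D] scale[OF st(2), of V]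
    scale[OF sb(2), of V] scale[OF s(2), of W] scale[OF s(2), of F]
    scale[OF t(2), of F] scale[OF t(2), of D] scale[OF t(2), of E] scale[OF bb, of E]
    mult_right_mono[OF t(2) mult_nonneg_nonneg[OF s(1) zero_le_power2[of V]]]
  have "F\<^sup>2 \<le> (D + \<beta> * E)\<^sup>2" using F nn by (intro power_mono) auto
  \<comment> \<open>The coefficient of the square of \<open>F\<close> is at most 1/3 + s + 22/9 t <
    0.61. The weight 3/2 keeps \<open>D\<close> within the available 1 - 2t - 3st, and the weight 3
    keeps \<open>E\<close> within (1 - t)/3.\<close>
  then have F2: "F\<^sup>2 \<le> 3/2 * D\<^sup>2 + 3 * (\<beta>\<^sup>2 * E\<^sup>2)"
    using young[of 1 "1/2" 2 D "\<beta> * E"] by (simp add: power2_sum power_mult_distrib)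
  have nn2: "0 \<le> s * V\<^sup>2" "0 \<le> D\<^sup>2" "0 \<le> E\<^sup>2" "0 \<le> s * \<beta> * P\<^sup>2" "0 \<le> s * \<beta> * E\<^sup>2"
    using s sb by simp_all
  \<comment> \<open>With all products split, the claim is linear in the monomials.\<close>
  have "7/3 * (s * W\<^sup>2) + 1/3 * F\<^sup>2 - W\<^sup>2 + 2 * (W * (\<beta> * E)) - \<beta>\<^sup>2 * E\<^sup>2 - D\<^sup>2 + 2 * (t * D\<^sup>2)
      + 2 * (s * V * W) + 2 * (s * F * W) + 2 * (s * t * P * D) + 2 * (s * t * V * D)
      + 2 * (s * \<beta> * P * E) + 2 * (s * \<beta> * V * E) + 4 * (t * P * F) - t * P\<^sup>2 - 2 * (t * F\<^sup>2)
    \<le> 7/3 * (s * V\<^sup>2) + 1/3 * E\<^sup>2 - 7/3 * (t * (s * V\<^sup>2)) - 1/3 * (t * E\<^sup>2)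
      + 100 * (s * \<beta> * P\<^sup>2) + 100/3 * (s * \<beta> * E\<^sup>2)"
    using young_terms[simplified] scale_terms[simplified mult.assoc] F2 nn2
    unfolding power_mult_distrib by linarith
  then show ?thesis
    by (simp add: algebra_simps diff_divide_distrib)
qed

text \<open>The vectors \<open>g0\<close>, \<open>g1\<close>, \<open>gz\<close> are $\lambda B$ at $u_{k-1}$, $u_k$, $z$.\<close>

lemma step_vector_bound:
  fixes p d e w g0 g1 gz :: "'a::real_inner"
  assumes s: "0 \<le> s" "s \<le> 1/5" and t: "0 \<le> t" "t \<le> 1/32" and b: "0 \<le> \<beta>" "\<beta> \<le> 1/4"
    and new: "inner (d - \<beta> *\<^sub>R e + w + g1) (p + d - \<beta> *\<^sub>R e + w) \<le> 0"
    and old: "inner (d + g0) (d - \<beta> *\<^sub>R e + w) \<ge> 0" "inner (d + g0) d \<le> 0"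
    and mono: "inner (g1 - gz) (p + d - \<beta> *\<^sub>R e) \<ge> t * (norm (p + d - \<beta> *\<^sub>R e))\<^sup>2"
    and lip: "norm (g1 - g0) \<le> s * norm ((d - e) + (d - \<beta> *\<^sub>R e))"
      "norm (g0 - gz) \<le> s * norm (p - (d - e))"
    and sol: "inner gz p \<ge> 0" "inner gz (p - d) \<ge> 0"
  shows "(norm (p + d - \<beta> *\<^sub>R e + w))\<^sup>2 + 7/3 * s * (norm w)\<^sup>2 + 2 * inner gz p
      + 1/3 * (norm (d - \<beta> *\<^sub>R e))\<^sup>2
    \<le> (1 - t + 100 * s * \<beta>) * ((norm p)\<^sup>2 + 7/3 * s * (norm (d - e))\<^sup>2 + 2 * inner gz (p - d)
      + 1/3 * (norm e)\<^sup>2)"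
proof -
  \<comment> \<open>In the application \<open>p\<close>, \<open>d\<close>, \<open>e\<close>,
    \<open>w\<close> are x_k - z, d_k, e_{k-1} and x_{k+1} - u_k, so \<open>f\<close> is e_k and
    \<open>v\<close> is x_k - u_{k-1}.\<close>
  define f where "f = d - \<beta> *\<^sub>R e"
  define v where "v = d - e"
  \<comment> \<open>The weighted sum of the three projection inequalities, with weights 2, 2 and 2(1
    - t), as a bilinear identity valid for arbitrary vectors.\<close>
  have id: "(norm p)\<^sup>2 + 2 * (1 - t) * inner gz (p - d) - (norm (w - \<beta> *\<^sub>R e))\<^sup>2 - (1 - 2 * t) * (norm d)\<^sup>2
      - 2 * inner (g1 - g0) w + 2 * inner (g0 - gz) (t *\<^sub>R d - \<beta> *\<^sub>R e) 
      - 2 * inner (g1 - gz) (p + d - \<beta> *\<^sub>R e)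
      - (norm (p + d - \<beta> *\<^sub>R e + w))\<^sup>2 - 2 * (2 - t) * inner gz p
    = - 2 * inner (d - \<beta> *\<^sub>R e + w + g1) (p + d - \<beta> *\<^sub>R e + w)
      + 2 * inner (d + g0) (d - \<beta> *\<^sub>R e + w) - 2 * (1 - t) * inner (d + g0) d"
    unfolding power2_norm_eq_inner by (simp add: inner_simps inner_commute algebra_simps)
  have "(1 - t) * inner (d + g0) d \<le> 0"
    using old(2) t by (simp add: mult_le_0_iff)
  then have A: "(norm (p + d - \<beta> *\<^sub>R e + w))\<^sup>2 + 2 * (2 - t) * inner gz p
    \<le> (norm p)\<^sup>2 + 2 * (1 - t) * inner gz (p - d) - (norm (w - \<beta> *\<^sub>R e))\<^sup>2 - (1 - 2 * t) * (norm d)\<^sup>2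
      - 2 * inner (g1 - g0) w + 2 * inner (g0 - gz) (t *\<^sub>R d - \<beta> *\<^sub>R e) - 2 * t * (norm (p + f))\<^sup>2"
    using id new old(1) mono unfolding f_def unfolding add_diff_eq[symmetric] by argo
  have B1: "- inner (g1 - g0) w \<le> s * (norm v + norm f) * norm w"
  proof -
    have "- inner (g1 - g0) w \<le> norm (g1 - g0) * norm w"
      using Cauchy_Schwarz_ineq2[of "g1 - g0" w] by linarith
    also have "\<dots> \<le> s * (norm v + norm f) * norm w"
      using lip(1) norm_triangle_ineq[of v f] s unfolding f_def[symmetric] v_def[symmetric]
      by (intro mult_right_mono) (auto intro: order_trans mult_left_mono)
    finally show ?thesis .
  qed
  have B2: "inner (g0 - gz) (t *\<^sub>R d - \<beta> *\<^sub>R e) \<le> s * (norm p + norm v) * (t * norm d + \<beta> * norm e)"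
  proof -
    have "inner (g0 - gz) (t *\<^sub>R d - \<beta> *\<^sub>R e) \<le> norm (g0 - gz) * norm (t *\<^sub>R d - \<beta> *\<^sub>R e)"
      by (rule norm_cauchy_schwarz)
    also have "\<dots> \<le> (s * (norm p + norm v)) * (t * norm d + \<beta> * norm e)"
    proof (rule mult_mono)
      show "norm (g0 - gz) \<le> s * (norm p + norm v)"
        using lip(2) norm_triangle_ineq4[of p v] s unfolding v_def[symmetric]
        by (auto intro: order_trans mult_left_mono)
      show "norm (t *\<^sub>R d - \<beta> *\<^sub>R e) \<le> t * norm d + \<beta> * norm e"
        using norm_triangle_ineq4[of "t *\<^sub>R d" "\<beta> *\<^sub>R e"] t b by simp
    qed (use s in auto)
    finally show ?thesis .
  qed
  have B3: "(norm (w - \<beta> *\<^sub>R e))\<^sup>2 \<ge> (norm w)\<^sup>2 - 2 * \<beta> * norm w * norm e + \<beta>\<^sup>2 * (norm e)\<^sup>2"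
  proof -
    have "\<beta> * inner w e \<le> \<beta> * (norm w * norm e)"
      using b norm_cauchy_schwarz[of w e] by (intro mult_left_mono) auto
    moreover have "(norm (w - \<beta> *\<^sub>R e))\<^sup>2 = (norm w)\<^sup>2 - 2 * (\<beta> * inner w e) + \<beta>\<^sup>2 * (norm e)\<^sup>2"
      unfolding power2_norm_eq_inner by (simp add: inner_simps inner_commute algebra_simps power2_eq_square)
    ultimately show ?thesis by (simp add: mult_ac)
  qed
  \<comment> \<open>Strong monotonicity yields decay at u_k rather than at x_k. Expanding around
    \<open>p\<close> pays for the contraction t of its square and still leaves -t times that square
    to absorb cross terms.\<close>
  have B4: "t * (norm p)\<^sup>2 - 2 * t * (norm (p + f))\<^sup>2
      \<le> t * (4 * norm p * norm f - (norm p)\<^sup>2 - 2 * (norm f)\<^sup>2)"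
  proof -
    have "- inner p f \<le> norm p * norm f"
      using Cauchy_Schwarz_ineq2[of p f] by linarith
    then have "(norm p)\<^sup>2 - 2 * (norm (p + f))\<^sup>2 \<le> 4 * norm p * norm f - (norm p)\<^sup>2 - 2 * (norm f)\<^sup>2"
      unfolding power2_norm_eq_inner by (simp add: inner_simps inner_commute mult.commute)
    from mult_left_mono[OF this t(1)] show ?thesis by (simp add: algebra_simps)
  qed
  have "norm f \<le> norm d + \<beta> * norm e"
    using norm_triangle_ineq4[of d "\<beta> *\<^sub>R e"] b by (simp add: f_def)
  note scalar = step_scalar_bound[OF s t b norm_ge_zero norm_ge_zero norm_ge_zero norm_ge_zero norm_ge_zero
      norm_ge_zero this, of w v p]
  \<comment> \<open>Two nonnegative surpluses are discarded: \<open>A\<close> carries weight 2(2 -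
    t) on \<open>inner gz p\<close> where the Lyapunov term has 2, and the factor
    \<open>100 * s * \<beta>\<close> multiplies the whole Lyapunov value while the scalar bound uses
    only its \<open>p\<close> and \<open>e\<close> parts.\<close>
  have "0 \<le> (1 - t) * inner gz p"
    using t sol by simp
  moreover have "0 \<le> s * \<beta> * (7/3 * s * (norm v)\<^sup>2 + 2 * inner gz (p - d))"
    using s b sol by simp
  moreover have "2 * (2 - t) * inner gz p = 2 * inner gz p + 2 * ((1 - t) * inner gz p)"
    by (simp add: algebra_simps)
  moreover have "(1 - t + 100 * s * \<beta>) * ((norm p)\<^sup>2 + 7/3 * s * (norm v)\<^sup>2 + 2 * inner gz (p - d)
      + 1/3 * (norm e)\<^sup>2)
    = (1 - t) * (7/3 * s * (norm v)\<^sup>2 + 1/3 * (norm e)\<^sup>2)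
      + 100 * s * \<beta> * ((norm p)\<^sup>2 + 1/3 * (norm e)\<^sup>2) + ((norm p)\<^sup>2 - t * (norm p)\<^sup>2)
      + 2 * (1 - t) * inner gz (p - d)
      + 100 * (s * \<beta> * (7/3 * s * (norm v)\<^sup>2 + 2 * inner gz (p - d)))"
    by (simp add: algebra_simps add_divide_distrib diff_divide_distrib)
  moreover have "- 2 * inner (g1 - g0) w \<le> 2 * s * (norm v + norm f) * norm w"
    "2 * inner (g0 - gz) (t *\<^sub>R d - \<beta> *\<^sub>R e) \<le> 2 * s * (norm p + norm v) * (t * norm d + \<beta> * norm e)"
    using B1 B2 by linarith+
  ultimately show ?thesis
    using A B3 B4 scalar unfolding f_def[symmetric] v_def[symmetric]
    by linarith
qed

section \<open>Lyapunov descent along the iterates\<close>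

text \<open>At a positive index none of the initial conventions occurs; the step size is grouped
  with \<open>L\<close> and \<open>B z\<close> to match \<open>step_vector_bound\<close>.\<close>

lemma lyapunov_Suc:
  "lyapunov B L lam z x u (Suc j) = (norm (x (Suc j) - z))\<^sup>2
    + 7/3 * (lam * L) * (norm (x (Suc j) - u j))\<^sup>2 + 2 * inner (lam *\<^sub>R B z) (x j - z)
    + 1/3 * (norm (u j - x j))\<^sup>2"
  by (simp add: lyapunov_def prev_def)

text \<open>Both \<open>x (Suc j)\<close> and \<open>x (Suc (Suc j))\<close> are projections, so
  their variational inequalities can be tested with \<open>x j\<close>,
  \<open>x (Suc (Suc j))\<close> and \<open>z\<close>; the rest translates iterates into the vectors
  of \<open>step_vector_bound\<close>.\<close>

lemma lyapunov_step:
  fixes C :: "'a::{real_inner, complete_space} set"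
  assumes C: "C \<noteq> {}" "closed C" "convex C"
    and lip: "L-lipschitz_on UNIV B" and sm: "strongly_monotone \<sigma> B" and z: "z \<in> vi_solutions C B"
    and pos: "0 < lam" "0 < L" "0 < \<sigma>" and small: "lam * L \<le> 1/5" "lam * \<sigma> \<le> 1/32"
    and beta: "0 \<le> b" "b \<le> 1/4" and xj: "x j \<in> C"
    and x1: "x (Suc j) = metric_projection C (x j - lam *\<^sub>R B (u j))"
    and x2: "x (Suc (Suc j)) = metric_projection C (x (Suc j) - lam *\<^sub>R B (u (Suc j)))"
    and u1: "u (Suc j) = x (Suc j) + (1 - b) *\<^sub>R (x (Suc j) - x j) + b *\<^sub>R (x (Suc j) - u j)"
  shows "lyapunov B L lam z x u (Suc (Suc j))
    \<le> (1 - lam * \<sigma> + 100 * (lam * L) * b) * lyapunov B L lam z x u (Suc j)"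
proof -
  define p where "p = x (Suc j) - z"
  define d where "d = x (Suc j) - x j"
  define e where "e = u j - x j"
  define w where "w = x (Suc (Suc j)) - u (Suc j)"
  have zC: "z \<in> C" and sol: "\<And>y. y \<in> C \<Longrightarrow> inner (lam *\<^sub>R B z) (y - z) \<ge> 0"
    using z pos by (auto simp: vi_solutions_def)
  have x1C: "x (Suc j) \<in> C" and x2C: "x (Suc (Suc j)) \<in> C"
    unfolding x1 x2 by (rule metric_projection_mem_inner(1)[OF C])+
  have proj1: "inner (d + lam *\<^sub>R B (u j)) (y - x (Suc j)) \<ge> 0" if "y \<in> C" for y
    using metric_projection_mem_inner(2)[OF C that, of "x j - lam *\<^sub>R B (u j)"]
    unfolding x1[symmetric] d_def by (simp add: algebra_simps)
  have proj2: "inner (x (Suc (Suc j)) - x (Suc j) + lam *\<^sub>R B (u (Suc j))) (y - x (Suc (Suc j))) \<ge> 0"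
    if "y \<in> C" for y
    using metric_projection_mem_inner(2)[OF C that, of "x (Suc j) - lam *\<^sub>R B (u (Suc j))"]
    unfolding x2[symmetric] by (simp add: algebra_simps)
  have lipB: "norm (lam *\<^sub>R B y - lam *\<^sub>R B y') \<le> (lam * L) * norm (y - y')" for y y'
  proof -
    have "lam * norm (B y - B y') \<le> lam * (L * norm (y - y'))"
      using lipschitz_on_normD[OF lip, of y y'] pos by simp
    then show ?thesis
      using pos by (simp add: scaleR_diff_right[symmetric])
  qed
  have monoB: "inner (lam *\<^sub>R B y - lam *\<^sub>R B y') (y - y') \<ge> (lam * \<sigma>) * (norm (y - y'))\<^sup>2" for y y'
  proof -
    have "lam * (\<sigma> * (norm (y - y'))\<^sup>2) \<le> lam * inner (B y - B y') (y - y')"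
      using sm pos by (simp add: strongly_monotone_def)
    then show ?thesis by (simp add: scaleR_diff_right[symmetric])
  qed
  \<comment> \<open>Since \<open>x (Suc j) - u j\<close> equals \<open>d - e\<close>, the two
    correction terms add up to (1 - b) d + b (d - e).\<close>
  have f: "d - b *\<^sub>R e = u (Suc j) - x (Suc j)"
    unfolding d_def e_def u1 by (simp add: algebra_simps)
  have dw: "d - b *\<^sub>R e + w = x (Suc (Suc j)) - x (Suc j)"
    unfolding f w_def by simp
  have pf: "p + d - b *\<^sub>R e = u (Suc j) - z"
    unfolding add_diff_eq[symmetric] f by (simp add: p_def)
  have pw: "p + d - b *\<^sub>R e + w = x (Suc (Suc j)) - z"
    unfolding pf w_def by simp
  have v: "d - e = x (Suc j) - u j" and pd: "p - d = x j - z"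
    unfolding d_def e_def p_def by simp_all
  have pv: "p - (d - e) = u j - z" and vf: "(d - e) + (d - b *\<^sub>R e) = u (Suc j) - u j"
    unfolding v f p_def by simp_all
  have new: "inner (d - b *\<^sub>R e + w + lam *\<^sub>R B (u (Suc j))) (p + d - b *\<^sub>R e + w) \<le> 0"
    unfolding dw pw using proj2[OF zC] by (simp add: inner_diff_right)
  have old: "inner (d + lam *\<^sub>R B (u j)) (d - b *\<^sub>R e + w) \<ge> 0" "inner (d + lam *\<^sub>R B (u j)) d \<le> 0"
  proof -
    show "inner (d + lam *\<^sub>R B (u j)) (d - b *\<^sub>R e + w) \<ge> 0"
      unfolding dw by (rule proj1[OF x2C])
    have "x j - x (Suc j) = - d" by (simp add: d_def)
    then show "inner (d + lam *\<^sub>R B (u j)) d \<le> 0"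
      using proj1[OF xj] by simp
  qed
  have "(norm (p + d - b *\<^sub>R e + w))\<^sup>2 + 7/3 * (lam * L) * (norm w)\<^sup>2 + 2 * inner (lam *\<^sub>R B z) p
      + 1/3 * (norm (d - b *\<^sub>R e))\<^sup>2
    \<le> (1 - lam * \<sigma> + 100 * (lam * L) * b) * ((norm p)\<^sup>2 + 7/3 * (lam * L) * (norm (d - e))\<^sup>2
      + 2 * inner (lam *\<^sub>R B z) (p - d) + 1/3 * (norm e)\<^sup>2)"
  proof (rule step_vector_bound[OF _ small(1) _ small(2) beta new old])
    show "inner (lam *\<^sub>R B (u (Suc j)) - lam *\<^sub>R B z) (p + d - b *\<^sub>R e)
        \<ge> lam * \<sigma> * (norm (p + d - b *\<^sub>R e))\<^sup>2"
      unfolding pf by (rule monoB)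
    show "norm (lam *\<^sub>R B (u (Suc j)) - lam *\<^sub>R B (u j)) \<le> lam * L * norm ((d - e) + (d - b *\<^sub>R e))"
      unfolding vf by (rule lipB)
    show "norm (lam *\<^sub>R B (u j) - lam *\<^sub>R B z) \<le> lam * L * norm (p - (d - e))"
      unfolding pv by (rule lipB)
    show "inner (lam *\<^sub>R B z) p \<ge> 0" "inner (lam *\<^sub>R B z) (p - d) \<ge> 0"
      unfolding pd unfolding p_def using sol x1C xj by blast+
  qed (use pos in auto)
  then show ?thesis
    unfolding lyapunov_Suc pw f pd v unfolding p_def w_def e_def .
qed

section \<open>From the recursion to geometric rates\<close>

text \<open>Every term of the Lyapunov sequence is nonnegative, the one with \<open>B z\<close>
  because the iterates stay in \<open>C\<close>. Its decay therefore controls the errors and, one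
  index later, the extrapolation steps.\<close>

lemma lyapunov_lower_bounds:
  assumes "0 < lam" "0 < L" "z \<in> vi_solutions C B" "\<And>k. x k \<in> C"
  shows "(norm (x k - z))\<^sup>2 \<le> lyapunov B L lam z x u k"
    and "1/3 * (norm (u k - x k))\<^sup>2 \<le> lyapunov B L lam z x u (Suc k)"
proof -
  have "0 \<le> inner (B z) (x i - z)" for i
    using assms(3,4) by (simp add: vi_solutions_def)
  then show "(norm (x k - z))\<^sup>2 \<le> lyapunov B L lam z x u k"
    and "1/3 * (norm (u k - x k))\<^sup>2 \<le> lyapunov B L lam z x u (Suc k)"
    using assms(1,2) by (auto simp: lyapunov_def prev_def split: nat.split)
qed

text \<open>The recursion starts at index 1, so \<open>a 1 / \<rho>\<close> replaces the initial
  value. Each factor is at most \<open>\<rho> * (1 + \<delta> j / \<rho>\<^sup>2)\<close> because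
  \<open>\<rho> \<le> 1\<close>.\<close>

lemma perturbed_geometric_bound:
  fixes a \<delta> :: "nat \<Rightarrow> real"
  assumes "0 < \<rho>" "\<rho> \<le> 1" "\<And>j. 0 \<le> \<delta> j" "\<And>k. 0 \<le> a k"
    and step: "\<And>j. a (Suc (Suc j)) \<le> (\<rho> + \<delta> j) * a (Suc j)"
  shows "a (Suc k) \<le> a 1 / \<rho> * (\<Prod>j<k. 1 + \<delta> j / \<rho>\<^sup>2) * \<rho> ^ Suc k"
proof (induction k)
  case 0
  then show ?case using assms(1) by simp
next
  case (Suc k)
  have "\<rho> + \<delta> k \<le> \<rho> * (1 + \<delta> k / \<rho>\<^sup>2)"
    using assms(1,2) assms(3)[of k]
    by (simp add: power2_eq_square field_simps mult_left_le_one_le)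
  then have "(\<rho> + \<delta> k) * a (Suc k)
      \<le> (\<rho> * (1 + \<delta> k / \<rho>\<^sup>2)) * (a 1 / \<rho> * (\<Prod>j<k. 1 + \<delta> j / \<rho>\<^sup>2) * \<rho> ^ Suc k)"
    using Suc.IH assms(1,3,4) by (intro mult_mono) auto
  also have "\<dots> = a 1 / \<rho> * (\<Prod>j<Suc k. 1 + \<delta> j / \<rho>\<^sup>2) * \<rho> ^ Suc (Suc k)"
    by (simp only: prod.lessThan_Suc power_Suc mult_ac)
  finally show ?case using step[of k] by linarith
qed

text \<open>Taking square roots gives the constant \<open>sqrt M\<close> at every index.\<close>

lemma bigo_powr_half:
  fixes f :: "nat \<Rightarrow> 'a::real_normed_vector"
  assumes "0 < \<rho>" "\<And>k. (norm (f k))\<^sup>2 \<le> M * \<rho> ^ k"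
  shows "(\<lambda>k. norm (f k)) \<in> O(\<lambda>k. \<rho> powr (real k / 2))"
proof (rule bigoI[of _ "sqrt M"], rule always_eventually, rule allI)
  fix k
  have "norm (f k) \<le> sqrt (M * \<rho> ^ k)"
    using assms(2) by (rule real_le_rsqrt)
  also have "\<dots> = sqrt M * \<rho> powr (real k / 2)"
    using assms(1) by (simp add: real_sqrt_mult powr_half_sqrt[symmetric] powr_powr powr_realpow[symmetric])
  finally show "norm (norm (f k)) \<le> sqrt M * norm (\<rho> powr (real k / 2))" by simp
qed

section \<open>Convergence and rates for the iteration\<close>

theorem theorem7p3:
  fixes C :: "'a::{real_inner, complete_space} set"
    and B :: "'a \<Rightarrow> 'a"
    and x u :: "nat \<Rightarrow> 'a"
    and z :: 'a
    and L \<sigma> lam \<rho> K :: real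
    and \<beta> \<theta> \<epsilon> a :: "nat \<Rightarrow> real"
  assumes "C \<noteq> {}" and "closed C" and "convex C"
    and "L > 0" and "L-lipschitz_on UNIV B"
    and "\<sigma> > 0" and "strongly_monotone \<sigma> B"
    and "z \<in> vi_solutions C B"
    and "\<forall>k. 0 \<le> \<beta> k \<and> \<beta> k \<le> 1 / 4" and "summable \<beta>"
    and "\<forall>k. \<theta> k = 1 - \<beta> k"
    and "x 0 \<in> C" and "u 0 = x 0"
    and "0 < lam" and "lam \<le> min (1 / (5 * L)) (1 / (32 * \<sigma>))"
    and "\<forall>k. x (k + 1) = metric_projection C (x k - lam *\<^sub>R B (u k))"
    and "\<forall>k\<ge>1. u k = x k + \<theta> k *\<^sub>R (x k - x (k - 1)) + \<beta> k *\<^sub>R (x k - u (k - 1))"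
    and "\<rho> = 1 - lam * \<sigma>"
    and "\<forall>k. \<epsilon> k = 100 * lam * L * \<beta> k"
    and "\<forall>k. a k = lyapunov B L lam z x u k"
    and "K = max (a 0) (a 1 / \<rho>) * prodinf (\<lambda>j. 1 + \<epsilon> (j + 1) / \<rho>\<^sup>2)"
  shows "vi_solutions C B = {z}
    \<and> x \<longlonglongrightarrow> z
    \<and> convergent_prod (\<lambda>j. 1 + \<epsilon> (j + 1) / \<rho>\<^sup>2)
    \<and> (\<forall>k. (norm (x k - z))\<^sup>2 \<le> K * (1 - lam * \<sigma>) ^ k)
    \<and> (\<lambda>k. norm (x k - z)) \<in> O(\<lambda>k. (1 - lam * \<sigma>) powr (real k / 2))
    \<and> (\<lambda>k. norm (x (k + 1) - x k)) \<in> O(\<lambda>k. (1 - lam * \<sigma>) powr (real k / 2))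
    \<and> (\<lambda>k. norm (u k - x k)) \<in> O(\<lambda>k. (1 - lam * \<sigma>) powr (real k / 2))"
proof -
  define q where "q = (\<lambda>j. 1 + \<epsilon> (j + 1) / \<rho>\<^sup>2)"
  have a: "a = lyapunov B L lam z x u"
    using assms(20) by blast
  have small: "lam * L \<le> 1/5" "lam * \<sigma> \<le> 1/32"
    using assms(4,6,15) by (simp_all add: field_simps)
  have rho: "0 < \<rho>" "\<rho> < 1"
    using assms(4,6,14,18) small by auto
  have eps: "0 \<le> \<epsilon> k" for k
    using assms(4,9,14,19) by simp
  have xC: "x k \<in> C" for k
    using assms(12,16) metric_projection_mem_inner(1)[OF assms(1-3)] by (cases k) auto
  have lower: "(norm (x k - z))\<^sup>2 \<le> a k" "1/3 * (norm (u k - x k))\<^sup>2 \<le> a (Suc k)" for k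
    unfolding a by (rule lyapunov_lower_bounds[OF assms(14,4,8) xC])+
  have a_nonneg: "0 \<le> a k" for k
    using lower(1)[of k] by (meson order_trans zero_le_power2)
  \<comment> \<open>The recursion for \<open>u\<close> holds from index 1 on, hence the shift to
    \<open>\<epsilon> (j + 1)\<close>.\<close>
  have step: "a (Suc (Suc j)) \<le> (\<rho> + \<epsilon> (j + 1)) * a (Suc j)" for j
  proof -
    have "u (Suc j) = x (Suc j) + (1 - \<beta> (Suc j)) *\<^sub>R (x (Suc j) - x j) + \<beta> (Suc j) *\<^sub>R (x (Suc j) - u j)"
      using assms(11,17) by auto
    note lyapunov_step[where x = x and u = u and j = j, OF assms(1-3,5,7,8,14,4,6) small _ _ xC _ _ this]
    then show ?thesis
      using assms(9,16,18,19) by (simp add: a mult_ac)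
  qed
  have "summable (\<lambda>j. norm (q j - 1))"
  proof -
    have "summable (\<lambda>j. (100 * lam * L / \<rho>\<^sup>2) * \<beta> (j + 1))"
      using assms(10) by (intro summable_mult summable_ignore_initial_segment)
    then show ?thesis
      using eps by (simp add: q_def assms(19))
  qed
  then have conv: "convergent_prod q"
    by (intro abs_convergent_prod_imp_convergent_prod summable_imp_abs_convergent_prod)
  \<comment> \<open>Factors of at least 1 make the infinite product dominate every partial product,
    so one constant \<open>K\<close> serves all indices.\<close>
  have q1: "1 \<le> q j" for j
    using eps rho by (simp add: q_def)
  have partial: "prod q {..<k} \<le> prodinf q" for k
    using conv q1 by (intro prod_le_prodinf convergent_prod_has_prod) (auto intro: order_trans[OF zero_le_one])
  have K: "K = max (a 0) (a 1 / \<rho>) * prodinf q"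
    using assms(21) by (simp add: q_def)
  have aK: "a k \<le> K * \<rho> ^ k" for k
  proof (cases k)
    case 0
    have "a 0 * 1 \<le> max (a 0) (a 1 / \<rho>) * prodinf q"
      using partial[of 0] a_nonneg by (intro mult_mono) (auto simp: le_max_iff_disj)
    then show ?thesis using 0 K by simp
  next
    case (Suc i)
    have "a (Suc i) \<le> a 1 / \<rho> * prod q {..<i} * \<rho> ^ Suc i"
      unfolding q_def using rho eps a_nonneg step by (intro perturbed_geometric_bound) auto
    also have "\<dots> \<le> K * \<rho> ^ Suc i"
      unfolding K using partial[of i] a_nonneg rho
      by (intro mult_right_mono mult_mono) (auto simp: le_max_iff_disj intro!: prod_nonneg order_trans[OF zero_le_one q1])
    finally show ?thesis using Suc by simp
  qed
  have K0: "0 \<le> K"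
    using aK[of 0] a_nonneg[of 0] by simp
  have bound: "(norm (x k - z))\<^sup>2 \<le> K * \<rho> ^ k" for k
    using lower(1) aK by (rule order_trans)
  have decr: "K * \<rho> ^ Suc k \<le> K * \<rho> ^ k" for k
    using K0 rho by (intro mult_left_mono power_decreasing) auto
  have lim: "x \<longlonglongrightarrow> z"
  proof -
    have "(\<lambda>k. (norm (x k - z))\<^sup>2) \<longlonglongrightarrow> 0"
    proof (rule tendsto_sandwich[OF _ _ tendsto_const])
      show "(\<lambda>k. K * \<rho> ^ k) \<longlonglongrightarrow> 0"
        using rho by (intro tendsto_mult_right_zero LIMSEQ_power_zero) simp
    qed (use bound in auto)
    from tendsto_real_sqrt[OF this] show ?thesis
      by (simp add: LIM_zero_iff tendsto_norm_zero_iff)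
  qed
  have "(\<lambda>k. norm (x (k + 1) - x k)) \<in> O(\<lambda>k. \<rho> powr (real k / 2))"
  proof (rule bigo_powr_half[OF rho(1)])
    fix k
    \<comment> \<open>The factor 4 comes from doubling each of two squared errors, both at most
      \<open>K * \<rho> ^ k\<close>.\<close>
    show "(norm (x (k + 1) - x k))\<^sup>2 \<le> (4 * K) * \<rho> ^ k"
    proof -
      have "norm (x (k + 1) - x k) \<le> norm (x (k + 1) - z) + norm (x k - z)"
        using norm_triangle_ineq4[of "x (k + 1) - z" "x k - z"] by simp
      then have "(norm (x (k + 1) - x k))\<^sup>2 \<le> (norm (x (k + 1) - z) + norm (x k - z))\<^sup>2"
        by (intro power_mono) auto
      also have "\<dots> \<le> 2 * (norm (x (k + 1) - z))\<^sup>2 + 2 * (norm (x k - z))\<^sup>2"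
        using sum_squares_bound[of "norm (x (k + 1) - z)" "norm (x k - z)"] by (simp add: power2_sum)
      finally show ?thesis
        using bound[of k] bound[of "k + 1"] decr[of k] by simp
    qed
  qed
  moreover have "(\<lambda>k. norm (u k - x k)) \<in> O(\<lambda>k. \<rho> powr (real k / 2))"
  proof (rule bigo_powr_half[OF rho(1)])
    \<comment> \<open>The extrapolation step enters \<open>a (Suc k)\<close> with weight 1/3, whence
      the factor 3; the index shift only helps since \<open>\<rho> < 1\<close>.\<close>
    show "(norm (u k - x k))\<^sup>2 \<le> (3 * K) * \<rho> ^ k" for k
      using lower(2)[of k] aK[of "Suc k"] decr[of k] by linarith
  qed
  ultimately show ?thesis
    using vi_solutions_unique[OF assms(6,7,8)] lim conv bound bigo_powr_half[OF rho(1) bound]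
    unfolding q_def assms(18) by blast
qed

end
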